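(* Let $N\ge 2$, let $P\subset\mathbb{R}^N_{>0}$ be finite and nonempty, and let $a\in\mathbb{R}^N_{>0}$ be componentwise worse than all points of $P$, i.e. $a_i\ge p_i$ for all $p\in P$ and all $i$. Then $$I_a(P)=R_2(\{a\})-R_2(P)=\int_{U(b(P))\setminus U(b(a))}\frac{dx}{(x_1+\cdots+x_N)^{N+1}}.$$
   Context: $\Delta_{N-1}=\{w\in\mathbb{R}^N_{\ge0}:w_1+\cdots+w_N=1\}$ is the weight simplex, equipped with the measure $dw=dw_1\cdots dw_{N-1}$ (Lebesgue measure in the first $N-1$ coordinates). For $p\in\mathbb{R}^N_{>0}$, $g_p(w)=\max_{i}w_ip_i$. For finite nonempty $P\subset\mathbb{R}^N_{>0}$, $\tau_P(w)=\min_{p\in P}g_p(w)$ and $R_2(P)=\int_{\Delta_{N-1}}\tau_P(w)\,dw$. The anchor-normalised improvement is $I_a(P)=R_2(\{a\})-R_2(P)$. For $p\in\mathbb{R}^N_{>0}$, $b(p)=(1/p_1,\ldots,1/p_N)$ and $b(P)=\{b(p):p\in P\}$. For a set $Q\subset\mathbb{R}^N_{>0}$, $U(Q)=\bigcup_{q\in Q}\prod_{i=1}^N[0,q_i]$; for a single point $u$, $U(u)=U(\{u\})=\prod_{i=1}^N[0,u_i]$. *)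

theory Defs
  imports "HOL-Analysis.Analysis"
begin

text \<open>
  A vector of \<open>\<real>\<^sup>N\<close> is a function \<^typ>\<open>nat \<Rightarrow> real\<close> that is extensional on the index set
  \<open>{1..N}\<close>, i.e. a point of the measure space \<open>lebesgue_pow N\<close>.
\<close>

definition lebesgue_pow :: "nat \<Rightarrow> (nat \<Rightarrow> real) measure" where
  "lebesgue_pow N = (\<Pi>\<^sub>M i\<in>{1..N}. lborel)"

definition pos_orthant :: "nat \<Rightarrow> (nat \<Rightarrow> real) set" where
  "pos_orthant N = ({1..N} \<rightarrow>\<^sub>E {0<..})"

definition weight_simplex :: "nat \<Rightarrow> (nat \<Rightarrow> real) set" where
  "weight_simplex N = {w \<in> {1..N} \<rightarrow>\<^sub>E {0..}. (\<Sum>i = 1..N. w i) = 1}"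

text \<open>
  The measure \<open>dw = dw\<^sub>1 \<cdots> dw\<^sub>N\<^sub>-\<^sub>1\<close> on the hyperplane \<open>w\<^sub>1 + \<cdots> + w\<^sub>N = 1\<close>: Lebesgue measure in
  the first \<open>N - 1\<close> coordinates, transported along the graph map that computes the last
  coordinate from the others. It is meant for \<open>N \<ge> 1\<close>.
\<close>

definition hyperplane_measure :: "nat \<Rightarrow> (nat \<Rightarrow> real) measure" where
  "hyperplane_measure N =
     distr (lebesgue_pow (N - 1)) (lebesgue_pow N) (\<lambda>v. v(N := 1 - (\<Sum>i = 1..N - 1. v i)))"

definition weighted_max :: "nat \<Rightarrow> (nat \<Rightarrow> real) \<Rightarrow> (nat \<Rightarrow> real) \<Rightarrow> real" where
  "weighted_max N p w = Max ((\<lambda>i. w i * p i) ` {1..N})"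

definition tau :: "nat \<Rightarrow> (nat \<Rightarrow> real) set \<Rightarrow> (nat \<Rightarrow> real) \<Rightarrow> real" where
  "tau N P w = Min ((\<lambda>p. weighted_max N p w) ` P)"

definition R2 :: "nat \<Rightarrow> (nat \<Rightarrow> real) set \<Rightarrow> real" where
  "R2 N P = (LINT w:weight_simplex N|hyperplane_measure N. tau N P w)"

definition improvement :: "nat \<Rightarrow> (nat \<Rightarrow> real) \<Rightarrow> (nat \<Rightarrow> real) set \<Rightarrow> real" where
  "improvement N a P = R2 N {a} - R2 N P"

definition recip :: "nat \<Rightarrow> (nat \<Rightarrow> real) \<Rightarrow> (nat \<Rightarrow> real)" where
  "recip N p = (\<lambda>i\<in>{1..N}. 1 / p i)"

definition box_union :: "nat \<Rightarrow> (nat \<Rightarrow> real) set \<Rightarrow> (nat \<Rightarrow> real) set" where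
  "box_union N Q = (\<Union>q\<in>Q. \<Pi>\<^sub>E i\<in>{1..N}. {0..q i})"

end

theory Submission
  imports Defs
begin

text \<open>
  In the coordinates \<open>x = r w\<close> with \<open>r = x\<^sub>1 + \<cdots> + x\<^sub>N\<close> and \<open>w\<close> on the hyperplane
  \<open>w\<^sub>1 + \<cdots> + w\<^sub>N = 1\<close>, Lebesgue measure becomes \<open>r\<^sup>N\<^sup>-\<^sup>1 dr dw\<close>. Since
  \<open>r w \<in> U(b(P))\<close> holds iff \<open>r w\<^sub>i p\<^sub>i \<le> 1\<close> for some \<open>p \<in> P\<close> and all \<open>i\<close>, the ray through a
  weight \<open>w\<close> meets \<open>U(b(P)) - U(b(a))\<close> exactly for
  \<open>1 / g\<^sub>a(w) < r \<le> 1 / \<tau>\<^sub>P(w)\<close>. The integrand \<open>r\<^sup>-\<^sup>N\<^sup>-\<^sup>1\<close> leaves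
  \<open>\<integral> r\<^sup>-\<^sup>2 dr = g\<^sub>a(w) - \<tau>\<^sub>P(w)\<close> on each ray.
\<close>

section \<open>Dilations of product Lebesgue measure\<close>

lemma nn_integral_PiM_lborel_scale:
  fixes f :: "('a \<Rightarrow> real) \<Rightarrow> ennreal"
  assumes "finite I" "c > 0" "f \<in> borel_measurable (\<Pi>\<^sub>M i\<in>I. lborel)"
  shows "(\<integral>\<^sup>+x. f x \<partial>(\<Pi>\<^sub>M i\<in>I. lborel)) =
    ennreal (c ^ card I) * (\<integral>\<^sup>+x. f (\<lambda>i\<in>I. c * x i) \<partial>(\<Pi>\<^sub>M i\<in>I. lborel))"
  using assms(1,3)
proof (induction I arbitrary: f)
  case empty
  show ?case by (simp add: PiM_empty nn_integral_count_space_finite restrict_def)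
next
  case (insert i I)
  interpret product_sigma_finite "\<lambda>_::'a. lborel :: real measure" by standard
  note [measurable] = insert.prems
  let ?P = "\<lambda>I. \<Pi>\<^sub>M i\<in>I. (lborel :: real measure)"
  interpret I: sigma_finite_measure "?P I"
    by (rule sigma_finite) fact
  have [measurable]: "(\<lambda>(v, y). v(i := y)) \<in> ?P I \<Otimes>\<^sub>M borel \<rightarrow>\<^sub>M ?P (insert i I)"
    using measurable_add_dim[of i I "\<lambda>_. lborel :: real measure"] by simp
  have [measurable]: "(\<lambda>v. \<lambda>j\<in>I. c * v j) \<in> ?P I \<rightarrow>\<^sub>M ?P I" for I :: "'a set"
    by measurable
  have eq: "(\<lambda>j\<in>I. c * v j)(i := c * y) = (\<lambda>j\<in>insert i I. c * (v(i := y)) j)" for v :: "'a \<Rightarrow> real" and y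
    using insert.hyps by (auto simp: fun_eq_iff)
  \<comment> \<open>The new coordinate \<open>y\<close> becomes the outer variable, so for fixed
    \<open>y\<close> the induction hypothesis applies to \<open>f (v(i := y))\<close> as a function
    of \<open>v\<close>; this is why \<open>f\<close> is generalised. The last factor
    \<open>c\<close> comes from the one-dimensional substitution in \<open>y\<close>.\<close>
  have "(\<integral>\<^sup>+x. f x \<partial>?P (insert i I)) = (\<integral>\<^sup>+y. \<integral>\<^sup>+v. f (v(i := y)) \<partial>?P I \<partial>lborel)"
    using insert by (intro product_nn_integral_insert_rev) auto
  also have "\<dots> = (\<integral>\<^sup>+y. ennreal (c ^ card I) * (\<integral>\<^sup>+v. f ((\<lambda>j\<in>I. c * v j)(i := y)) \<partial>?P I) \<partial>lborel)"
    by (intro nn_integral_cong insert.IH) measurable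
  also have "\<dots> = ennreal (c ^ card I) * (\<integral>\<^sup>+y. (\<integral>\<^sup>+v. f ((\<lambda>j\<in>I. c * v j)(i := y)) \<partial>?P I) \<partial>lborel)"
    by (intro nn_integral_cmult) measurable
  also have "(\<integral>\<^sup>+y. (\<integral>\<^sup>+v. f ((\<lambda>j\<in>I. c * v j)(i := y)) \<partial>?P I) \<partial>lborel) =
     ennreal c * (\<integral>\<^sup>+y. (\<integral>\<^sup>+v. f ((\<lambda>j\<in>I. c * v j)(i := c * y)) \<partial>?P I) \<partial>lborel)"
    using \<open>c > 0\<close> by (subst nn_integral_real_affine[where c = c and t = 0]) auto
  also have "(\<integral>\<^sup>+y. (\<integral>\<^sup>+v. f ((\<lambda>j\<in>I. c * v j)(i := c * y)) \<partial>?P I) \<partial>lborel) =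
     (\<integral>\<^sup>+x. f (\<lambda>j\<in>insert i I. c * x j) \<partial>?P (insert i I))"
    unfolding eq using insert by (intro product_nn_integral_insert_rev[symmetric]) auto
  finally show ?case
    using \<open>c > 0\<close> by (simp only: card_insert_disjoint[OF insert.hyps] power_Suc2 ennreal_mult
        less_imp_le zero_le_power mult.assoc)
qed

section \<open>Polar coordinates over the hyperplane\<close>

lemma sets_lebesgue_pow [measurable_cong]: "sets (lebesgue_pow N) = sets (\<Pi>\<^sub>M i\<in>{1..N}. lborel)"
  by (simp add: lebesgue_pow_def)

lemma space_lebesgue_pow: "space (lebesgue_pow N) = {1..N} \<rightarrow>\<^sub>E UNIV"
  by (simp add: lebesgue_pow_def space_PiM)

lemma sigma_finite_lebesgue_pow: "sigma_finite_measure (lebesgue_pow N)"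
proof -
  interpret product_sigma_finite "\<lambda>_::nat. lborel :: real measure" by standard
  show ?thesis by (simp add: lebesgue_pow_def sigma_finite)
qed

lemma measurable_fun_upd_lebesgue_pow:
  "(\<lambda>(v, y). v(Suc M := y)) \<in> lebesgue_pow M \<Otimes>\<^sub>M borel \<rightarrow>\<^sub>M lebesgue_pow (Suc M)"
  using measurable_add_dim[of "Suc M" "{1..M}" "\<lambda>_. lborel :: real measure"]
  by (simp add: lebesgue_pow_def atLeastAtMostSuc_conv)

lemma sets_hyperplane_measure [measurable_cong]:
  "sets (hyperplane_measure N) = sets (\<Pi>\<^sub>M i\<in>{1..N}. lborel)"
  by (simp add: hyperplane_measure_def lebesgue_pow_def)

lemma nn_integral_hyperplane_measure_Suc:
  assumes [measurable]: "f \<in> borel_measurable (lebesgue_pow (Suc M))"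
  shows "(\<integral>\<^sup>+w. f w \<partial>hyperplane_measure (Suc M)) =
    (\<integral>\<^sup>+v. f (v(Suc M := 1 - (\<Sum>i = 1..M. v i))) \<partial>lebesgue_pow M)"
proof -
  note [measurable] = measurable_fun_upd_lebesgue_pow
  show ?thesis
    unfolding hyperplane_measure_def by (subst nn_integral_distr) simp_all
qed

text \<open>Replacing the last coordinate by the coordinate sum \<open>r\<close> is a shear, of
  Jacobian 1. On the slice of sum \<open>r > 0\<close>, dilating the \<open>N - 1\<close> free
  coordinates by \<open>r\<close> carries the slice of sum 1 onto it and yields the factor
  \<open>r ^ (N - 1)\<close>. The weights run over the whole hyperplane, with coordinates of either
  sign.\<close>

lemma nn_integral_lebesgue_pow_polar:
  fixes f :: "(nat \<Rightarrow> real) \<Rightarrow> ennreal"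
  assumes "N \<ge> 1" and f: "f \<in> borel_measurable (lebesgue_pow N)"
  shows "(\<integral>\<^sup>+x. f x * indicator {x. 0 < (\<Sum>i = 1..N. x i)} x \<partial>lebesgue_pow N) =
    (\<integral>\<^sup>+w. (\<integral>\<^sup>+r. ennreal (r ^ (N - 1)) * f (\<lambda>i\<in>{1..N}. r * w i) * indicator {0<..} r \<partial>lborel)
      \<partial>hyperplane_measure N)"
proof -
  obtain M where N: "N = Suc M" using \<open>N \<ge> 1\<close> by (cases N) auto
  interpret product_sigma_finite "\<lambda>_::nat. lborel :: real measure" by standard
  interpret M: sigma_finite_measure "lebesgue_pow M" by (rule sigma_finite_lebesgue_pow)
  interpret pair: pair_sigma_finite "lebesgue_pow M" "lborel :: real measure" ..
  note [measurable] = f[unfolded N] measurable_fun_upd_lebesgue_pow[of M]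
  have I: "{1..Suc M} = insert (Suc M) {1..M}" by auto
  let ?s = "\<lambda>v::nat \<Rightarrow> real. \<Sum>i = 1..M. v i"
  have upd: "(\<lambda>v. v(Suc M := 1 - ?s v)) \<in> lebesgue_pow M \<rightarrow>\<^sub>M lebesgue_pow N"
    unfolding N by measurable
  have mult: "(\<lambda>(w, r). \<lambda>i\<in>{1..N}. r * w i) \<in> lebesgue_pow N \<Otimes>\<^sub>M borel \<rightarrow>\<^sub>M lebesgue_pow N"
    by measurable
  have [measurable]: "(\<lambda>(v, r). f (\<lambda>i\<in>{1..N}. r * (v(Suc M := 1 - ?s v)) i)) \<in>
      borel_measurable (lebesgue_pow M \<Otimes>\<^sub>M borel)"
    using measurable_compose[OF measurable_Pair[OF measurable_compose[OF measurable_fst upd] measurable_snd]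
        measurable_compose[OF mult f]]
    by (simp add: split_beta')
  have [measurable]: "(\<lambda>(w, r). f (\<lambda>i\<in>{1..N}. r * w i)) \<in> borel_measurable (lebesgue_pow N \<Otimes>\<^sub>M borel)"
    using measurable_compose[OF mult f] by (simp add: split_beta')
  have radial_meas: "(\<lambda>w. \<integral>\<^sup>+r. ennreal (r ^ (N - 1)) * f (\<lambda>i\<in>{1..N}. r * w i) *
      indicator {0<..} r \<partial>lborel) \<in> borel_measurable (lebesgue_pow N)"
    by measurable
  have scale: "(\<integral>\<^sup>+v. f (v(Suc M := r - ?s v)) \<partial>lebesgue_pow M) =
      (\<integral>\<^sup>+v. ennreal (r ^ M) * f (\<lambda>i\<in>{1..N}. r * (v(Suc M := 1 - ?s v)) i) \<partial>lebesgue_pow M)"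
    if "r > 0" for r
  proof -
    \<comment> \<open>Dilating the free coordinates also dilates the dependent one, as
      \<open>r - r s = r (1 - s)\<close>; the whole vector is thus \<open>r\<close> times a point of
      the hyperplane.\<close>
    have eq: "(\<lambda>i\<in>{1..M}. r * v i)(Suc M := r - ?s (\<lambda>i\<in>{1..M}. r * v i)) =
        (\<lambda>i\<in>{1..N}. r * (v(Suc M := 1 - ?s v)) i)" for v
      unfolding N I by (auto simp: fun_eq_iff right_diff_distrib sum_distrib_left)
    have "(\<lambda>v. f (v(Suc M := r - ?s v))) \<in> borel_measurable (lebesgue_pow M)"
      by measurable
    then have "(\<integral>\<^sup>+v. f (v(Suc M := r - ?s v)) \<partial>lebesgue_pow M) =
      ennreal (r ^ M) *
      (\<integral>\<^sup>+v. f ((\<lambda>i\<in>{1..M}. r * v i)(Suc M := r - ?s (\<lambda>i\<in>{1..M}. r * v i))) \<partial>lebesgue_pow M)"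
      unfolding lebesgue_pow_def
      by (subst nn_integral_PiM_lborel_scale[of "{1..M}" r]) (use that in auto)
    also have "\<dots> = (\<integral>\<^sup>+v. ennreal (r ^ M) * f (\<lambda>i\<in>{1..N}. r * (v(Suc M := 1 - ?s v)) i) \<partial>lebesgue_pow M)"
      unfolding eq by (rule nn_integral_cmult[symmetric]) measurable
    finally show ?thesis .
  qed
  have "(\<lambda>x. f x * indicator {0<..} (?s x + x (Suc M))) \<in> borel_measurable (lebesgue_pow (Suc M))"
    by measurable
  then have f': "(\<lambda>x. f x * indicator {0<..} (?s x + x (Suc M))) \<in>
      borel_measurable (\<Pi>\<^sub>M i\<in>insert (Suc M) {1..M}. lborel)"
    unfolding lebesgue_pow_def I .
  have "(\<integral>\<^sup>+x. f x * indicator {x. 0 < (\<Sum>i = 1..N. x i)} x \<partial>lebesgue_pow N) =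
      (\<integral>\<^sup>+x. f x * indicator {0<..} (?s x + x (Suc M)) \<partial>(\<Pi>\<^sub>M i\<in>insert (Suc M) {1..M}. lborel))"
    unfolding lebesgue_pow_def N I[symmetric]
    by (intro nn_integral_cong) (simp add: indicator_def)
  also have "\<dots> = (\<integral>\<^sup>+v. \<integral>\<^sup>+y. f (v(Suc M := y)) * indicator {0<..} (?s v + y) \<partial>lborel \<partial>lebesgue_pow M)"
    unfolding lebesgue_pow_def
    by (subst product_nn_integral_insert[OF _ _ f']) simp_all
  \<comment> \<open>The shear: for fixed \<open>v\<close>, the translation
    \<open>y = r - ?s v\<close> makes \<open>r\<close> the total sum.\<close>
  also have "\<dots> = (\<integral>\<^sup>+v. \<integral>\<^sup>+r. f (v(Suc M := r - ?s v)) * indicator {0<..} r \<partial>lborel \<partial>lebesgue_pow M)"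
  proof (rule nn_integral_cong)
    fix v assume v: "v \<in> space (lebesgue_pow M)"
    have "(\<lambda>(v, y). f (v(Suc M := y))) \<in> borel_measurable (lebesgue_pow M \<Otimes>\<^sub>M borel)"
      by measurable
    from measurable_Pair2[OF this v]
    have [measurable]: "(\<lambda>y. f (v(Suc M := y))) \<in> borel_measurable borel" by simp
    show "(\<integral>\<^sup>+y. f (v(Suc M := y)) * indicator {0<..} (?s v + y) \<partial>lborel) =
        (\<integral>\<^sup>+r. f (v(Suc M := r - ?s v)) * indicator {0<..} r \<partial>lborel)"
      by (subst nn_integral_real_affine[where c = 1 and t = "- ?s v"]) auto
  qed
  \<comment> \<open>\<open>scale\<close> dilates \<open>v\<close> at fixed \<open>r\<close>, so
    \<open>r\<close> has to be the outer variable. The order is restored afterwards, because the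
    hyperplane measure is an integral over \<open>v\<close>.\<close>
  also have "\<dots> = (\<integral>\<^sup>+r. \<integral>\<^sup>+v. f (v(Suc M := r - ?s v)) * indicator {0<..} r \<partial>lebesgue_pow M \<partial>lborel)"
    by (rule pair.Fubini'[symmetric]) measurable
  also have "\<dots> = (\<integral>\<^sup>+r. \<integral>\<^sup>+v. ennreal (r ^ M) * f (\<lambda>i\<in>{1..N}. r * (v(Suc M := 1 - ?s v)) i) *
      indicator {0<..} r \<partial>lebesgue_pow M \<partial>lborel)"
  proof (rule nn_integral_cong)
    show "(\<integral>\<^sup>+v. f (v(Suc M := r - ?s v)) * indicator {0<..} r \<partial>lebesgue_pow M) =
        (\<integral>\<^sup>+v. ennreal (r ^ M) * f (\<lambda>i\<in>{1..N}. r * (v(Suc M := 1 - ?s v)) i) *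
          indicator {0<..} r \<partial>lebesgue_pow M)" for r
      using scale[of r] by (cases "r > 0") simp_all
  qed
  also have "\<dots> = (\<integral>\<^sup>+v. \<integral>\<^sup>+r. ennreal (r ^ M) * f (\<lambda>i\<in>{1..N}. r * (v(Suc M := 1 - ?s v)) i) *
      indicator {0<..} r \<partial>lborel \<partial>lebesgue_pow M)"
    by (rule pair.Fubini') measurable
  also have "\<dots> = (\<integral>\<^sup>+w. (\<integral>\<^sup>+r. ennreal (r ^ (N - 1)) * f (\<lambda>i\<in>{1..N}. r * w i) * indicator {0<..} r \<partial>lborel)
      \<partial>hyperplane_measure N)"
    using radial_meas unfolding N by (subst nn_integral_hyperplane_measure_Suc) simp_all
  finally show ?thesis .
qed


section \<open>The weight simplex inside the hyperplane\<close>

text \<open>The sum condition holds at every point of the image of the graph map. The lemma lets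
  integrands be compared only at weights of sum 1, whatever they do elsewhere in the ambient
  space.\<close>

lemma AE_hyperplane_measure:
  assumes "N \<ge> 1"
  shows "AE w in hyperplane_measure N. w \<in> {1..N} \<rightarrow>\<^sub>E UNIV \<and> (\<Sum>i = 1..N. w i) = 1"
proof -
  obtain M where N: "N = Suc M" using \<open>N \<ge> 1\<close> by (cases N) auto
  note [measurable] = measurable_fun_upd_lebesgue_pow[of M]
  have "AE w in hyperplane_measure N. (\<Sum>i = 1..N. w i) = 1"
    unfolding hyperplane_measure_def N by (subst AE_distr_iff) simp_all
  moreover have "space (hyperplane_measure N) = {1..N} \<rightarrow>\<^sub>E UNIV"
    by (simp add: hyperplane_measure_def space_lebesgue_pow)
  ultimately show ?thesis
    using AE_space[of "hyperplane_measure N"] by simp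
qed

lemma weight_simplex_measurable [measurable]: "weight_simplex N \<in> sets (lebesgue_pow N)"
proof -
  have "weight_simplex N =
      {w \<in> space (lebesgue_pow N). (\<forall>i\<in>{1..N}. 0 \<le> w i) \<and> (\<Sum>i = 1..N. w i) = 1}"
    by (auto simp: weight_simplex_def space_lebesgue_pow PiE_iff)
  then show ?thesis by simp
qed

lemma weight_simplex_le_1:
  assumes "w \<in> weight_simplex N" "i \<in> {1..N}"
  shows "w i \<le> 1"
proof -
  have "w i \<le> (\<Sum>i = 1..N. w i)"
    using assms by (intro member_le_sum) (auto simp: weight_simplex_def PiE_iff)
  then show ?thesis using assms by (simp add: weight_simplex_def)
qed

text \<open>Pulled back along the graph map, the simplex lies in the unit cube of dimension
  \<open>N - 1\<close>, which has measure 1.\<close>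

lemma emeasure_weight_simplex_finite:
  assumes "N \<ge> 1"
  shows "emeasure (hyperplane_measure N) (weight_simplex N) < \<infinity>"
proof -
  obtain M where N: "N = Suc M" using \<open>N \<ge> 1\<close> by (cases N) auto
  interpret product_sigma_finite "\<lambda>_::nat. lborel :: real measure" by standard
  note [measurable] = measurable_fun_upd_lebesgue_pow[of M]
  let ?T = "\<lambda>v. v(Suc M := 1 - (\<Sum>i = 1..M. v i))"
  let ?B = "\<Pi>\<^sub>E i\<in>{1..M}. {0..1::real}"
  have "emeasure (hyperplane_measure N) (weight_simplex N) =
      emeasure (lebesgue_pow M) (?T -` weight_simplex N \<inter> space (lebesgue_pow M))"
    unfolding hyperplane_measure_def N by (subst emeasure_distr) simp_all
  also have "\<dots> \<le> emeasure (lebesgue_pow M) ?B"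
  proof (rule emeasure_mono)
    show "?T -` weight_simplex N \<inter> space (lebesgue_pow M) \<subseteq> ?B"
    proof
      fix v assume v: "v \<in> ?T -` weight_simplex N \<inter> space (lebesgue_pow M)"
      then have "?T v \<in> weight_simplex N" by simp
      then have "0 \<le> ?T v i" "?T v i \<le> 1" if "i \<in> {1..N}" for i
        using weight_simplex_le_1[of "?T v" N i] that by (auto simp: weight_simplex_def PiE_iff)
      then have "0 \<le> v i" "v i \<le> 1" if "i \<in> {1..M}" for i
        using that by (force simp: N)+
      then show "v \<in> ?B" using v by (auto simp: space_lebesgue_pow PiE_iff)
    qed
    show "?B \<in> sets (lebesgue_pow M)"
      unfolding lebesgue_pow_def by (rule sets_PiM_I_finite) auto
  qed
  also have "emeasure (lebesgue_pow M) ?B = 1"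
    unfolding lebesgue_pow_def by (subst emeasure_PiM) auto
  finally show ?thesis by (auto simp: less_top[symmetric] top_unique)
qed

section \<open>The function tau on the simplex\<close>

lemma pos_orthantD: "p \<in> pos_orthant N \<Longrightarrow> i \<in> {1..N} \<Longrightarrow> 0 < p i"
  by (auto simp: pos_orthant_def PiE_iff)

lemma weighted_max_le_iff:
  assumes "N \<ge> 1"
  shows "weighted_max N p w \<le> c \<longleftrightarrow> (\<forall>i\<in>{1..N}. w i * p i \<le> c)"
  using assms by (simp add: weighted_max_def)

text \<open>The minimum turns into an existential and the maximum into a universal quantifier, which
  is the logical shape of membership in a union of boxes.\<close>

lemma tau_le_iff:
  assumes "N \<ge> 1" "finite P" "P \<noteq> {}"
  shows "tau N P w \<le> c \<longleftrightarrow> (\<exists>p\<in>P. \<forall>i\<in>{1..N}. w i * p i \<le> c)"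
  using assms by (simp add: tau_def Min_le_iff weighted_max_le_iff)

lemma tau_measurable [measurable]:
  assumes "finite P"
  shows "tau N P \<in> borel_measurable (lebesgue_pow N)"
  using assms unfolding tau_def weighted_max_def by measurable

text \<open>Homogeneity of degree one, put in the form that decides how far along a ray the sublevel
  set at level 1 extends.\<close>

lemma tau_scale_le_iff:
  assumes "N \<ge> 1" "finite P" "P \<noteq> {}" "r > 0"
  shows "tau N P (\<lambda>i\<in>{1..N}. r * w i) \<le> 1 \<longleftrightarrow> tau N P w \<le> 1 / r"
proof -
  have "r * w i * p i \<le> 1 \<longleftrightarrow> w i * p i \<le> 1 / r" for p i
    using \<open>r > 0\<close> by (simp add: field_simps)
  then show ?thesis
    unfolding tau_le_iff[OF assms(1-3)] by simp
qed

text \<open>Coordinates with sum 1 cannot all be nonpositive. Positivity makes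
  \<open>1 / tau N P w\<close> a genuine radius rather than the default value of a division by
  zero.\<close>

lemma tau_pos:
  assumes "N \<ge> 1" "finite P" "P \<noteq> {}" "P \<subseteq> pos_orthant N" "w \<in> weight_simplex N"
  shows "tau N P w > 0"
proof (rule ccontr)
  assume "\<not> ?thesis"
  then obtain p where p: "p \<in> P" "\<forall>i\<in>{1..N}. w i * p i \<le> 0"
    using assms by (auto simp: not_less tau_le_iff)
  have "w i \<le> 0" if "i \<in> {1..N}" for i
  proof -
    have "p i > 0" using pos_orthantD p(1) that assms(4) by blast
    moreover have "w i * p i \<le> 0" using p(2) that by blast
    ultimately show ?thesis by (simp add: mult_le_0_iff)
  qed
  then have "(\<Sum>i = 1..N. w i) \<le> 0" by (intro sum_nonpos) auto
  with assms(5) show False by (simp add: weight_simplex_def)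
qed

text \<open>Any single point of \<open>P\<close> is a witness, since multiplying by nonnegative
  weights preserves domination. This orders the two radii on a ray and gives the difference of the
  two functions its sign.\<close>

lemma tau_antimono_dominated:
  assumes "N \<ge> 1" "finite P" "P \<noteq> {}" "\<forall>p\<in>P. \<forall>i\<in>{1..N}. p i \<le> a i" "w \<in> weight_simplex N"
  shows "tau N P w \<le> tau N {a} w"
proof -
  obtain p where p: "p \<in> P" using assms by auto
  have "\<forall>i\<in>{1..N}. w i * a i \<le> tau N {a} w"
    using tau_le_iff[of N "{a}" w "tau N {a} w"] assms by simp
  moreover have "w i * p i \<le> w i * a i" if "i \<in> {1..N}" for i
    using that p assms by (auto intro!: mult_left_mono simp: weight_simplex_def PiE_iff)
  ultimately have "\<forall>i\<in>{1..N}. w i * p i \<le> tau N {a} w"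
    by (blast intro: order_trans)
  then show ?thesis
    unfolding tau_le_iff[OF assms(1-3)] using p by blast
qed

text \<open>A bounded measurable function on a set of finite measure. For the bound, fix any
  \<open>p\<close> in \<open>P\<close>: weights are at most 1, so each \<open>w i * p i\<close> is
  at most \<open>p i\<close>, hence at most the sum of the coordinates of \<open>p\<close>.\<close>

lemma tau_set_integrable:
  assumes "N \<ge> 1" "finite P" "P \<noteq> {}" "P \<subseteq> pos_orthant N"
  shows "set_integrable (hyperplane_measure N) (weight_simplex N) (tau N P)"
proof -
  obtain p where p: "p \<in> P" using assms by auto
  have "\<bar>tau N P w\<bar> \<le> (\<Sum>i = 1..N. p i)" if w: "w \<in> weight_simplex N" for w
  proof -
    have "w i * p i \<le> (\<Sum>i = 1..N. p i)" if i: "i \<in> {1..N}" for i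
    proof -
      have nn: "p j \<ge> 0" if "j \<in> {1..N}" for j
        using pos_orthantD that p assms(4) by (blast intro: less_imp_le)
      have "w i * p i \<le> 1 * p i"
        using weight_simplex_le_1[OF w i] nn[OF i] by (intro mult_right_mono)
      also have "1 * p i \<le> (\<Sum>i = 1..N. p i)"
        using i nn by (simp, intro member_le_sum) auto
      finally show ?thesis .
    qed
    then have "tau N P w \<le> (\<Sum>i = 1..N. p i)"
      unfolding tau_le_iff[OF assms(1-3)] using p by blast
    with tau_pos[OF assms w] show ?thesis by simp
  qed
  moreover have "tau N P \<in> borel_measurable (hyperplane_measure N)"
    "weight_simplex N \<in> sets (hyperplane_measure N)"
    using tau_measurable[OF \<open>finite P\<close>, of N] weight_simplex_measurable[of N]
    by (simp_all add: hyperplane_measure_def)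
  ultimately show ?thesis
    unfolding set_integrable_def
    using emeasure_weight_simplex_finite[OF \<open>N \<ge> 1\<close>]
    by (intro integrableI_bounded_set_indicator[where B = "\<Sum>i = 1..N. p i"]) auto
qed

section \<open>Unions of reciprocal boxes as sublevel sets of tau\<close>

lemma mem_box_union_recip_iff:
  assumes "N \<ge> 1" "finite P" "P \<noteq> {}" "P \<subseteq> pos_orthant N"
  shows "x \<in> box_union N (recip N ` P) \<longleftrightarrow> x \<in> {1..N} \<rightarrow>\<^sub>E {0..} \<and> tau N P x \<le> 1"
proof -
  have "x i * p i \<le> 1 \<longleftrightarrow> x i \<le> recip N p i" if "p \<in> P" "i \<in> {1..N}" for p i
  proof -
    have "p i > 0" using pos_orthantD that assms(4) by blast
    then show ?thesis using that by (simp add: recip_def field_simps)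
  qed
  then have "tau N P x \<le> 1 \<longleftrightarrow> (\<exists>p\<in>P. \<forall>i\<in>{1..N}. x i \<le> recip N p i)"
    using assms by (simp add: tau_le_iff)
  then show ?thesis
    by (auto simp: box_union_def PiE_iff)
qed

lemma box_union_recip_measurable:
  assumes "N \<ge> 1" "finite P" "P \<noteq> {}" "P \<subseteq> pos_orthant N"
  shows "box_union N (recip N ` P) \<in> sets (lebesgue_pow N)"
proof -
  note [measurable] = tau_measurable[OF \<open>finite P\<close>, of N]
  have "box_union N (recip N ` P) =
      {x \<in> space (lebesgue_pow N). (\<forall>i\<in>{1..N}. 0 \<le> x i) \<and> tau N P x \<le> 1}"
    using mem_box_union_recip_iff[OF assms] by (auto simp: space_lebesgue_pow PiE_iff)
  also have "\<dots> \<in> sets (lebesgue_pow N)" by measurable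
  finally show ?thesis .
qed

section \<open>Integration along rays and the integral identity\<close>

lemma nn_integral_inverse_square:
  fixes A B :: real
  assumes "0 < B" "B \<le> A"
  shows "(\<integral>\<^sup>+r. ennreal (1 / r\<^sup>2) * indicator {1 / A <.. 1 / B} r \<partial>lborel) = ennreal (A - B)"
proof -
  have le: "1 / A \<le> 1 / B" and pos: "1 / A > 0" using assms by (auto simp: field_simps)
  \<comment> \<open>The antiderivative is \<open>- 1 / r\<close>; its values at the two ends are
    \<open>- B\<close> and \<open>- A\<close>.\<close>
  have "((\<lambda>r. 1 / r\<^sup>2) has_integral (- (1 / (1 / B)) - - (1 / (1 / A)))) {1 / A .. 1 / B}"
    by (rule fundamental_theorem_of_calculus[OF le],
        unfold has_real_derivative_iff_has_vector_derivative[symmetric])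
       (use pos in \<open>auto intro!: derivative_eq_intros simp: field_simps power2_eq_square\<close>)
  then have "(\<integral>\<^sup>+r. ennreal (1 / r\<^sup>2) * indicator {1 / A .. 1 / B} r \<partial>lborel) = ennreal (A - B)"
    using nn_integral_has_integral_lebesgue'[of "{1 / A .. 1 / B}" "\<lambda>r. 1 / r\<^sup>2" "A - B"] by simp
  \<comment> \<open>The interval is open on the left because the box of the anchor, a closed set, is
    removed; the missing endpoint is a null set.\<close>
  moreover have "(\<integral>\<^sup>+r. ennreal (1 / r\<^sup>2) * indicator {1 / A <.. 1 / B} r \<partial>lborel) =
      (\<integral>\<^sup>+r. ennreal (1 / r\<^sup>2) * indicator {1 / A .. 1 / B} r \<partial>lborel)"
    using AE_lborel_singleton[of "1 / A"]
    by (intro nn_integral_cong_AE) (auto elim!: eventually_mono simp: indicator_def)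
  ultimately show ?thesis by simp
qed


theorem corollary1:
  fixes N :: nat and P :: "(nat \<Rightarrow> real) set" and a :: "nat \<Rightarrow> real"
  assumes "N \<ge> 2"
    and "P \<subseteq> pos_orthant N" and "finite P" and "P \<noteq> {}"
    and "a \<in> pos_orthant N"
    and "\<forall>p\<in>P. \<forall>i\<in>{1..N}. a i \<ge> p i"
  shows "improvement N a P = R2 N {a} - R2 N P \<and>
    R2 N {a} - R2 N P =
      (LINT x:(box_union N (recip N ` P) - box_union N {recip N a})|lebesgue_pow N.
         1 / (\<Sum>i = 1..N. x i) ^ (N + 1))"
proof -
  have N: "N \<ge> 1" using assms(1) by simp
  note hP = N assms(3,4,2)
  have ha: "1 \<le> N" "finite {a}" "{a} \<noteq> {}" "{a} \<subseteq> pos_orthant N" using N assms(5) by auto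
  define D where "D = box_union N (recip N ` P) - box_union N {recip N a}"
  \<comment> \<open>The indicator is absorbed into the integrand, so that the polar formula, which
    concerns functions on the whole space, can be applied.\<close>
  define h where "h = (\<lambda>x. indicator D x * (1 / (\<Sum>i = 1..N. x i) ^ (N + 1)) :: real)"
  have D: "x \<in> D \<longleftrightarrow> x \<in> {1..N} \<rightarrow>\<^sub>E {0..} \<and> tau N P x \<le> 1 \<and> \<not> tau N {a} x \<le> 1" for x
    using mem_box_union_recip_iff[OF hP, of x] mem_box_union_recip_iff[OF ha, of x]
    by (auto simp: D_def)
  have D_sets: "D \<in> sets (lebesgue_pow N)"
    using box_union_recip_measurable[OF hP] box_union_recip_measurable[OF ha]
    by (auto simp: D_def)
  have [measurable]: "h \<in> borel_measurable (lebesgue_pow N)"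
    unfolding h_def using D_sets by measurable
  \<comment> \<open>A nonnegative vector of sum 0 is the origin, which lies in the removed box of
    \<open>a\<close>. So the singularity of the integrand is outside \<open>D\<close>, and
    restricting to positive sums loses nothing.\<close>
  have sum_pos: "(\<Sum>i = 1..N. x i) > 0" if "x \<in> D" for x
  proof (rule ccontr)
    have nn: "\<forall>i\<in>{1..N}. x i \<ge> 0" using that by (auto simp: D PiE_iff)
    assume "\<not> ?thesis"
    moreover have "(\<Sum>i = 1..N. x i) \<ge> 0" using nn by (intro sum_nonneg) auto
    ultimately have "(\<Sum>i = 1..N. x i) = 0" by simp
    then have "\<forall>i\<in>{1..N}. x i = 0"
      using nn by (subst (asm) sum_nonneg_eq_0_iff) auto
    then have "tau N {a} x \<le> 1"
      unfolding tau_le_iff[OF ha(1-3)] by simp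
    with that show False by (simp add: D)
  qed
  have ray: "(\<lambda>i\<in>{1..N}. r * w i) \<in> D \<longleftrightarrow>
      w \<in> weight_simplex N \<and> r \<in> {1 / tau N {a} w <.. 1 / tau N P w}"
    if r: "r > 0" and w: "w \<in> {1..N} \<rightarrow>\<^sub>E UNIV" "(\<Sum>i = 1..N. w i) = 1" for r w
  proof (cases "w \<in> weight_simplex N")
    case True
    then have "(\<lambda>i\<in>{1..N}. r * w i) \<in> {1..N} \<rightarrow>\<^sub>E {0..}"
      using r by (auto simp: weight_simplex_def PiE_iff)
    then show ?thesis
      using True r tau_pos[OF hP True] tau_pos[OF ha True]
      unfolding D tau_scale_le_iff[OF hP(1-3) r] tau_scale_le_iff[OF ha(1-3) r]
      by (auto simp: field_simps)
  next
    \<comment> \<open>A weight of sum 1 outside the simplex has a negative coordinate. It stays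
      negative under dilation by \<open>r > 0\<close>, so the whole ray misses
      \<open>D\<close>.\<close>
    case False
    then obtain i where i: "i \<in> {1..N}" "w i < 0"
      using w by (auto simp: weight_simplex_def PiE_iff not_le)
    then have "r * w i < 0" using r by (simp add: mult_less_0_iff)
    then have "(\<lambda>i\<in>{1..N}. r * w i) \<notin> {1..N} \<rightarrow>\<^sub>E {0..}"
      using i by (auto simp: PiE_iff not_le intro!: bexI[of _ i])
    then show ?thesis using False by (simp add: D)
  qed
  have radial: "(\<integral>\<^sup>+r. ennreal (r ^ (N - 1)) * ennreal (h (\<lambda>i\<in>{1..N}. r * w i)) * indicator {0<..} r \<partial>lborel) =
      ennreal (indicator (weight_simplex N) w * (tau N {a} w - tau N P w))"
    if w: "w \<in> {1..N} \<rightarrow>\<^sub>E UNIV" "(\<Sum>i = 1..N. w i) = 1" for w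
  proof -
    let ?I = "{1 / tau N {a} w <.. 1 / tau N P w}"
    have sum: "(\<Sum>i = 1..N. (\<lambda>i\<in>{1..N}. r * w i) i) = r" for r
      using w by (simp flip: sum_distrib_left)
    have h: "h (\<lambda>i\<in>{1..N}. r * w i) = indicator D (\<lambda>i\<in>{1..N}. r * w i) * (1 / r ^ (N + 1))" for r
      unfolding h_def sum ..
    have "ennreal (r ^ (N - 1)) * ennreal (h (\<lambda>i\<in>{1..N}. r * w i)) * indicator {0<..} r =
        ennreal (1 / r\<^sup>2) * indicator ?I r * indicator (weight_simplex N) w" for r
    proof (cases "r > 0")
      case True
      \<comment> \<open>The Jacobian lowers the exponent \<open>N + 1\<close> to 2. Since
        \<open>N - 1\<close> is truncated subtraction, \<open>N >= 1\<close> matters here.\<close>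
      have "r ^ (N + 1) = r ^ (N - 1) * r\<^sup>2"
        using N by (simp flip: power_add)
      then have "r ^ (N - 1) * (1 / r ^ (N + 1)) = 1 / r\<^sup>2"
        using True by simp
      then have "ennreal (r ^ (N - 1)) * ennreal (1 / r ^ (N + 1)) = ennreal (1 / r\<^sup>2)"
        using True by (simp flip: ennreal_mult)
      then show ?thesis
        using True ray[OF True w] unfolding h by (auto simp: indicator_def)
    next
      case False
      \<comment> \<open>The left side vanishes for \<open>r <= 0\<close> through its indicator; the
        right side does too, as \<open>?I\<close> starts at a positive radius.\<close>
      have "r \<notin> ?I" if "w \<in> weight_simplex N"
      proof -
        have "0 < 1 / tau N {a} w" using tau_pos[OF ha that] by simp
        with False have "\<not> 1 / tau N {a} w < r" by linarith
        then show ?thesis by simp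
      qed
      then show ?thesis using False by (auto simp: indicator_def)
    qed
    then have "(\<integral>\<^sup>+r. ennreal (r ^ (N - 1)) * ennreal (h (\<lambda>i\<in>{1..N}. r * w i)) * indicator {0<..} r \<partial>lborel) =
        (\<integral>\<^sup>+r. ennreal (1 / r\<^sup>2) * indicator ?I r \<partial>lborel) * indicator (weight_simplex N) w"
      by (simp add: nn_integral_multc)
    also have "\<dots> = ennreal (indicator (weight_simplex N) w * (tau N {a} w - tau N P w))"
      using nn_integral_inverse_square[OF tau_pos[OF hP]
          tau_antimono_dominated[OF hP(1-3) assms(6)], of w]
      by (auto simp: indicator_def)
    finally show ?thesis .
  qed
  have "R2 N {a} - R2 N P =
      (LINT w:weight_simplex N|hyperplane_measure N. tau N {a} w - tau N P w)"
    unfolding R2_def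
    by (rule set_integral_diff(2)[symmetric]) (intro tau_set_integrable hP ha)+
  \<comment> \<open>The polar formula is about nonnegative integrals, so the real integral is
    converted; domination by \<open>a\<close> supplies the sign.\<close>
  also have "\<dots> = enn2real (\<integral>\<^sup>+w. ennreal (indicator (weight_simplex N) w * (tau N {a} w - tau N P w))
      \<partial>hyperplane_measure N)"
  proof -
    have "integrable (hyperplane_measure N)
        (\<lambda>w. indicator (weight_simplex N) w * (tau N {a} w - tau N P w))"
      using set_integral_diff(1)[OF tau_set_integrable[OF ha] tau_set_integrable[OF hP]]
      by (simp add: set_integrable_def)
    then show ?thesis
      unfolding set_lebesgue_integral_def real_scaleR_def
      by (intro integral_eq_nn_integral)
        (auto simp: indicator_def intro!: tau_antimono_dominated[OF hP(1-3) assms(6)])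
  qed
  \<comment> \<open>The formula \<open>radial\<close> is read backwards: the difference is expanded
    into an integral along the ray through \<open>w\<close>, almost everywhere on the
    hyperplane.\<close>
  also have "\<dots> = enn2real (\<integral>\<^sup>+w. (\<integral>\<^sup>+r. ennreal (r ^ (N - 1)) * ennreal (h (\<lambda>i\<in>{1..N}. r * w i)) *
      indicator {0<..} r \<partial>lborel) \<partial>hyperplane_measure N)"
    by (intro arg_cong[where f = enn2real] nn_integral_cong_AE,
        rule eventually_mono[OF AE_hyperplane_measure[OF N]]) (simp only: radial)
  also have "\<dots> = enn2real (\<integral>\<^sup>+x. ennreal (h x) * indicator {x. 0 < (\<Sum>i = 1..N. x i)} x \<partial>lebesgue_pow N)"
    by (subst nn_integral_lebesgue_pow_polar[OF N]) auto
  also have "\<dots> = enn2real (\<integral>\<^sup>+x. ennreal (h x) \<partial>lebesgue_pow N)"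
    using sum_pos by (intro arg_cong[where f = enn2real] nn_integral_cong) (auto simp: h_def indicator_def)
  also have "\<dots> = (\<integral>x. h x \<partial>lebesgue_pow N)"
  proof (rule integral_eq_nn_integral[symmetric])
    show "AE x in lebesgue_pow N. 0 \<le> h x"
      using sum_pos by (auto simp: h_def indicator_def less_imp_le)
  qed measurable
  also have "\<dots> = (LINT x:D|lebesgue_pow N. 1 / (\<Sum>i = 1..N. x i) ^ (N + 1))"
    by (simp add: h_def set_lebesgue_integral_def)
  finally show ?thesis
    by (simp add: improvement_def D_def)
qed

end
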